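(* Let $\nu\ge1$, $s\ge1$, $t\ge0$ be integers. For all integers $0\le k\le n$, the $\nu$-order generalized $(s,t)$-Ward numbers $W^{(\nu)}(n,k;s,t)$ and the $(\nu+1)$-order $(s,t)$-Eulerian numbers $E^{(\nu+1)}_{(s,t)}(n,k)$ are related by $$W^{(\nu)}(n,k;s,t)=\sum_{j=0}^k E^{(\nu+1)}_{(s,t)}(n,j)\binom{n-j}{n-k},$$ $$E^{(\nu+1)}_{(s,t)}(n,k)=\sum_{j=0}^k(-1)^{k-j}\,W^{(\nu)}(n,j;s,t)\binom{n-j}{n-k}.$$
   Context: For an integer $m\ge1$, the $m$-order $(s,t)$-Eulerian numbers $E^{(m)}_{(s,t)}(n,k)$ are defined by $$E^{(m)}_{(s,t)}(n,k)=(k+s)\,E^{(m)}_{(s,t)}(n-1,k)+(m n-k+t+1-m)\,E^{(m)}_{(s,t)}(n-1,k-1)+\delta_{k0}\delta_{n0},$$ with $E^{(m)}_{(s,t)}(n,k)=0$ if $n<0$ or $k<0$. The $\nu$-order generalized $(s,t)$-Ward numbers are defined by $$W^{(\nu)}(n,k;s,t)=(k+s)\,W^{(\nu)}(n-1,k;s,t)+(\nu n+k+s+t-1-\nu)\,W^{(\nu)}(n-1,k-1;s,t)+\delta_{k0}\delta_{n0},$$ with $W^{(\nu)}(n,k;s,t)=0$ if $n<0$ or $k<0$. *)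

theory Defs
  imports Main
begin

function eulerian :: "int \<Rightarrow> int \<Rightarrow> int \<Rightarrow> int \<Rightarrow> int \<Rightarrow> int" where
  "eulerian m s t n k =
    (if n < 0 \<or> k < 0 then 0
     else (k + s) * eulerian m s t (n - 1) k
        + (m * n - k + t + 1 - m) * eulerian m s t (n - 1) (k - 1)
        + (if k = 0 \<and> n = 0 then 1 else 0))"
  by pat_completeness auto
termination
  by (relation "measure (\<lambda>(m, s, t, n, k). nat (n + 1))") auto

function ward :: "int \<Rightarrow> int \<Rightarrow> int \<Rightarrow> int \<Rightarrow> int \<Rightarrow> int" where
  "ward \<nu> n k s t =
    (if n < 0 \<or> k < 0 then 0
     else (k + s) * ward \<nu> (n - 1) k s t
        + (\<nu> * n + k + s + t - 1 - \<nu>) * ward \<nu> (n - 1) (k - 1) s t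
        + (if k = 0 \<and> n = 0 then 1 else 0))"
  by pat_completeness auto
termination
  by (relation "measure (\<lambda>(\<nu>, n, k, s, t). nat (n + 1))") auto

(* The unconditional recursion equations would make the simplifier loop. *)
declare eulerian.simps [simp del] ward.simps [simp del]

end

theory Submission
  imports Defs
begin

text \<open>
  Both families of numbers are triangles of the same kind: they satisfy
  \<open>A(n+1,k) = (k + s) A(n,k) + (\<alpha> n - x k + \<gamma>) A(n,k-1)\<close> with \<open>A(0,k) = \<delta>\<^sub>k\<^sub>0\<close>, the Eulerian
  numbers with \<open>x = 1\<close> and the Ward numbers with \<open>x = -1\<close>. The two claimed formulas are the
  cases \<open>x = 1\<close> and \<open>x = -1\<close> of the binomial transform
  \<open>B(n,k) = (\<Sum>j\<le>k. x ^ (k - j) * A(n,j) * (n - j choose (k - j)))\<close>, which in terms of row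
  polynomials is \<open>B\<^sub>n(y) = (1 + x y)\<^sup>n A\<^sub>n(y / (1 + x y))\<close>.

  This transform maps a triangle with parameters \<open>(\<alpha>, x, \<gamma>)\<close> to the one with parameters
  \<open>(\<alpha> - x, -x, \<gamma> + x s - 2 x)\<close> and the same \<open>s\<close> (lemma \<open>binomial_transform_triangle\<close>). In
  particular it is an involution on these parameter triples, and it exchanges the Eulerian triple
  \<open>(\<nu> + 1, 1, t + 1)\<close> with the Ward triple \<open>(\<nu>, -1, s + t - 1)\<close>. One lemma therefore yields
  both formulas.

  The lemma holds by induction on \<open>n\<close>: comparing the coefficients of each \<open>A(n,j)\<close> on
  both sides leaves Pascal's rule and the absorption identity
  \<open>(r + 1) (N choose (r + 1)) = (N - r) (N choose r)\<close>. The slope \<open>-x\<close> in \<open>k\<close> has to be tied to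
  the base \<open>x\<close> of the powers because that is what makes the \<open>j\<close>-dependence cancel.
\<close>

fun triangle :: "'a::comm_ring_1 \<Rightarrow> 'a \<Rightarrow> 'a \<Rightarrow> 'a \<Rightarrow> nat \<Rightarrow> nat \<Rightarrow> 'a" where
  "triangle s \<alpha> x \<gamma> 0 k = (if k = 0 then 1 else 0)"
| "triangle s \<alpha> x \<gamma> (Suc n) 0 = s * triangle s \<alpha> x \<gamma> n 0"
| "triangle s \<alpha> x \<gamma> (Suc n) (Suc k) =
     (of_nat (Suc k) + s) * triangle s \<alpha> x \<gamma> n (Suc k)
     + (\<alpha> * of_nat n - x * of_nat (Suc k) + \<gamma>) * triangle s \<alpha> x \<gamma> n k"

lemma triangle_eq_0: "n < k \<Longrightarrow> triangle s \<alpha> x \<gamma> n k = 0"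
proof (induction n arbitrary: k)
  case (Suc n)
  then show ?case by (cases k) auto
qed simp

lemma of_nat_binomial_absorb:
  "of_nat (Suc r) * of_nat (n choose Suc r)
     = (of_nat n - of_nat r) * (of_nat (n choose r) :: 'a::comm_ring_1)"
proof (cases "r \<le> n")
  case True
  have "Suc r * (n choose Suc r) = (n - r) * (n choose r)"
    by (simp only: binomial_absorb_comp binomial_absorption)
  then have "of_nat (Suc r) * of_nat (n choose Suc r)
      = (of_nat (n - r) * of_nat (n choose r) :: 'a)"
    by (metis of_nat_mult)
  with True show ?thesis by (simp add: of_nat_diff)
qed (simp add: binomial_eq_0)

text \<open>
  The coefficient comparison behind the transform: with \<open>N = n - j\<close> and \<open>r = k - j\<close>, the left side
  collects what a single entry \<open>A(n,j)\<close> contributes to the transform of row \<open>n + 1\<close> at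
  \<open>k + 1\<close>, and the right side what it contributes to the recurrence of the transformed triangle.
\<close>

lemma transform_coefficient:
  fixes s \<alpha> x \<gamma> :: "'a::comm_ring_1"
  assumes "j \<le> k" "j \<le> n"
  shows "(of_nat j + s) * (x ^ Suc (k - j) * of_nat (Suc (n - j) choose Suc (k - j)))
      + (\<alpha> * of_nat n - x * of_nat (Suc j) + \<gamma>) * (x ^ (k - j) * of_nat (n - j choose (k - j)))
    = (of_nat (Suc k) + s) * (x ^ Suc (k - j) * of_nat (n - j choose Suc (k - j)))
      + ((\<alpha> - x) * of_nat n - (- x) * of_nat (Suc k) + (\<gamma> + x * s - 2 * x))
        * (x ^ (k - j) * of_nat (n - j choose (k - j)))"
proof -
  obtain r N where r: "k = j + r" and N: "n = j + N"
    using assms by (metis le_Suc_ex)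
  define c d :: 'a where "c = of_nat (N choose r)" and "d = of_nat (N choose Suc r)"
  have absorb: "(1 + of_nat r) * d = (of_nat N - of_nat r) * c"
    using of_nat_binomial_absorb[of r N, where 'a = 'a] by (simp add: c_def d_def)
  have "((of_nat j + s) * (x * x ^ r * (c + d))
      + (\<alpha> * (of_nat j + of_nat N) - x * (1 + of_nat j) + \<gamma>) * (x ^ r * c))
    - ((1 + of_nat j + of_nat r + s) * (x * x ^ r * d)
      + ((\<alpha> - x) * (of_nat j + of_nat N) + x * (1 + of_nat j + of_nat r)
          + (\<gamma> + x * s - 2 * x)) * (x ^ r * c))
    = x * x ^ r * ((of_nat N - of_nat r) * c - (1 + of_nat r) * d)"
    by (simp add: algebra_simps)
  also have "\<dots> = 0" by (simp add: absorb)
  finally show ?thesis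
    by (simp add: r N c_def d_def algebra_simps)
qed

text \<open>
  The formula holds for every \<open>k\<close>: beyond \<open>k = n\<close> both sides vanish, each summand on the right
  through \<open>A(n,j) = 0\<close> for \<open>j > n\<close> or through its binomial coefficient for \<open>j \<le> n\<close>.
\<close>

lemma binomial_transform_triangle:
  fixes s \<alpha> x \<gamma> :: "'a::comm_ring_1"
  shows "triangle s (\<alpha> - x) (- x) (\<gamma> + x * s - 2 * x) n k
    = (\<Sum>j\<le>k. triangle s \<alpha> x \<gamma> n j * (x ^ (k - j) * of_nat (n - j choose (k - j))))"
proof (induction n arbitrary: k)
  case 0
  have "(\<Sum>j\<le>k. triangle s \<alpha> x \<gamma> 0 j * (x ^ (k - j) * of_nat (0 - j choose (k - j))))
      = (\<Sum>j\<in>{0}. triangle s \<alpha> x \<gamma> 0 j * (x ^ (k - j) * of_nat (0 - j choose (k - j))))"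
    by (rule sum.mono_neutral_right) auto
  then show ?case by (cases k) simp_all
next
  case (Suc n)
  show ?case
  proof (cases k)
    case 0
    then show ?thesis using Suc.IH[of 0] by simp
  next
    case (Suc l)
    let ?A = "triangle s \<alpha> x \<gamma>"
    let ?w = "\<lambda>n k j. x ^ (k - j) * of_nat (n - j choose (k - j)) :: 'a"
    let ?p = "\<lambda>j. \<alpha> * of_nat n - x * of_nat (Suc j) + \<gamma>"
    let ?q = "(\<alpha> - x) * of_nat n - (- x) * of_nat (Suc l) + (\<gamma> + x * s - 2 * x)"
    \<comment> \<open>Collect by entries of row \<open>n\<close>: each \<open>A(n,j)\<close> enters \<open>A(n+1,j)\<close> and \<open>A(n+1,j+1)\<close>.\<close>
    have "(\<Sum>j\<le>Suc l. ?A (Suc n) j * ?w (Suc n) (Suc l) j)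
        = (\<Sum>j\<le>Suc l. (of_nat j + s) * ?A n j * ?w (Suc n) (Suc l) j)
          + (\<Sum>j\<le>l. ?p j * ?A n j * ?w n l j)"
      unfolding sum.atMost_Suc_shift
      by (simp add: distrib_right sum.distrib add.assoc del: binomial_Suc_Suc of_nat_Suc)
    also have "\<dots> = (\<Sum>j\<le>l. ?A n j * ((of_nat j + s) * ?w (Suc n) (Suc l) j + ?p j * ?w n l j))
          + (of_nat (Suc l) + s) * ?A n (Suc l)"
      by (simp add: distrib_left sum.distrib mult_ac add_ac of_nat_Suc[of 0]
          del: binomial_Suc_Suc of_nat_Suc power_Suc)
    also have "(\<Sum>j\<le>l. ?A n j * ((of_nat j + s) * ?w (Suc n) (Suc l) j + ?p j * ?w n l j))
        = (\<Sum>j\<le>l. ?A n j * ((of_nat (Suc l) + s) * ?w n (Suc l) j + ?q * ?w n l j))"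
    proof (rule sum.cong[OF refl])
      fix j assume "j \<in> {..l}"
      then have "j \<le> l" by simp
      show "?A n j * ((of_nat j + s) * ?w (Suc n) (Suc l) j + ?p j * ?w n l j)
          = ?A n j * ((of_nat (Suc l) + s) * ?w n (Suc l) j + ?q * ?w n l j)"
      proof (cases "j \<le> n")
        case True
        show ?thesis
          using transform_coefficient[OF \<open>j \<le> l\<close> True, of s x \<alpha> \<gamma>] \<open>j \<le> l\<close> True
          by (simp only: Suc_diff_le)
      qed (simp add: triangle_eq_0)
    qed
    also have "\<dots> + (of_nat (Suc l) + s) * ?A n (Suc l)
        = (of_nat (Suc l) + s) * (\<Sum>j\<le>Suc l. ?A n j * ?w n (Suc l) j)
          + ?q * (\<Sum>j\<le>l. ?A n j * ?w n l j)"
      by (simp add: distrib_left sum.distrib sum_distrib_left mult_ac add_ac of_nat_Suc[of 0]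
          del: of_nat_Suc power_Suc)
    also have "\<dots> = triangle s (\<alpha> - x) (- x) (\<gamma> + x * s - 2 * x) (Suc n) (Suc l)"
      by (simp only: triangle.simps Suc.IH)
    finally show ?thesis by (simp only: Suc)
  qed
qed

lemma eulerian_eq_triangle:
  "eulerian m s t (int n) (int k) = triangle s m 1 (t + 1) n k"
proof (induction n arbitrary: k)
  case 0
  then show ?case
    by (simp add: eulerian.simps[of m s t 0] eulerian.simps[of m s t "- 1"])
next
  case (Suc n)
  show ?case
  proof (cases k)
    case 0
    then show ?thesis
      using Suc.IH[of 0]
      by (simp add: eulerian.simps[of m s t "1 + int n"] eulerian.simps[of m s t _ "- 1"])
  next
    case (Suc l)
    then show ?thesis
      using Suc.IH[of l] Suc.IH[of "Suc l"]
      by (simp add: eulerian.simps[of m s t "1 + int n"] algebra_simps)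
  qed
qed

lemma ward_eq_triangle:
  "ward \<nu> (int n) (int k) s t = triangle s \<nu> (- 1) (s + t - 1) n k"
proof (induction n arbitrary: k)
  case 0
  then show ?case
    by (simp add: ward.simps[of \<nu> 0] ward.simps[of \<nu> "- 1"])
next
  case (Suc n)
  show ?case
  proof (cases k)
    case 0
    then show ?thesis
      using Suc.IH[of 0]
      by (simp add: ward.simps[of \<nu> "1 + int n"] ward.simps[of \<nu> _ "- 1"])
  next
    case (Suc l)
    then show ?thesis
      using Suc.IH[of l] Suc.IH[of "Suc l"]
      by (simp add: ward.simps[of \<nu> "1 + int n"] algebra_simps)
  qed
qed

theorem corollary19:
  fixes \<nu> s t :: int and n k :: nat
  assumes "\<nu> \<ge> 1" and "s \<ge> 1" and "t \<ge> 0" and "k \<le> n"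
  shows "ward \<nu> (int n) (int k) s t =
           (\<Sum>j = 0..k. eulerian (\<nu> + 1) s t (int n) (int j) * int ((n - j) choose (n - k)))
       \<and> eulerian (\<nu> + 1) s t (int n) (int k) =
           (\<Sum>j = 0..k. (- 1) ^ (k - j) * ward \<nu> (int n) (int j) s t * int ((n - j) choose (n - k)))"
proof -
  have choose_sym: "(n - j) choose (n - k) = (n - j) choose (k - j)" if "j \<le> k" for j
    using that \<open>k \<le> n\<close> binomial_symmetric[of "k - j" "n - j"] by simp
  have "ward \<nu> (int n) (int k) s t = triangle s (\<nu> + 1 - 1) (- 1) (t + 1 + 1 * s - 2 * 1) n k"
    by (simp add: ward_eq_triangle algebra_simps)
  also have "\<dots> = (\<Sum>j\<le>k. triangle s (\<nu> + 1) 1 (t + 1) n j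
      * (1 ^ (k - j) * int (n - j choose (k - j))))"
    using binomial_transform_triangle[of s "\<nu> + 1" 1 "t + 1" n k] by simp
  also have "\<dots> = (\<Sum>j = 0..k. eulerian (\<nu> + 1) s t (int n) (int j)
      * int ((n - j) choose (n - k)))"
    by (rule sum.cong) (auto simp: choose_sym eulerian_eq_triangle)
  finally have ward: "ward \<nu> (int n) (int k) s t = \<dots>" .
  have "eulerian (\<nu> + 1) s t (int n) (int k)
      = triangle s (\<nu> - (- 1)) (- (- 1)) (s + t - 1 + (- 1) * s - 2 * (- 1)) n k"
    by (simp add: eulerian_eq_triangle algebra_simps)
  also have "\<dots> = (\<Sum>j\<le>k. triangle s \<nu> (- 1) (s + t - 1) n j
      * ((- 1) ^ (k - j) * int (n - j choose (k - j))))"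
    using binomial_transform_triangle[of s \<nu> "- 1" "s + t - 1" n k] by simp
  also have "\<dots> = (\<Sum>j = 0..k. (- 1) ^ (k - j) * ward \<nu> (int n) (int j) s t
      * int ((n - j) choose (n - k)))"
    by (rule sum.cong) (auto simp: choose_sym ward_eq_triangle)
  finally have "eulerian (\<nu> + 1) s t (int n) (int k) = \<dots>" .
  with ward show ?thesis by blast
qed

end
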